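(* For $N\in\mathbb N$ let $(\Omega_N,\mathcal F_N,Q_N)$ be a sequence of probability spaces. Let $\mathcal X$ be a complete, separable metric space, $\mathcal W$ a relatively compact subset of $\mathcal X$ that is not closed and thus not compact, and $\mathcal Z$ the closure of $\mathcal W$ in $\mathcal X$; thus $\mathcal Z$ is compact. Let $Y_N$ be a sequence of random vectors mapping $\Omega_N$ into $\mathcal W$, and let $I$ be a function mapping $\mathcal X$ into $[0,\infty]$. For $A\subset\mathcal X$ denote the infimum of $I$ over $A$ by $I(A)$. Assume the following four hypotheses. (i) For $\omega\in\Omega_N$ the range of $Y_N(\omega)$ is a finite subset $\mathcal W_N$ of $\mathcal W$, and $$\lim_{N\to\infty}\frac1N\log\mathrm{card}(\mathcal W_N)=0.$$ (ii) For each $y\in\mathcal W_N$ we have $I(y)<\infty$ and the local large deviation estimate $$\frac1N\log Q_N(Y_N=y)=-I(y)+\varepsilon_N(y),$$ where $\varepsilon_N(y)\to0$ as $N\to\infty$ uniformly for $y\in\mathcal W_N$. (iii) There exists a dense subset $\mathcal D$ of $\mathcal W$ such that $I(y)<\infty$ for all $y\in\mathcal D$. (iv) For any $y\in\mathcal W$ satisfying $I(y)<\infty$, there exists a sequence $y_N\in\mathcal W_N$ for which $y_N\to y$ and $I(y_N)\to I(y)$ as $N\to\infty$. Under these hypotheses the following conclusions hold. (a) For any open ball $B$ in $\mathcal W$, $I(B)$ is finite, and $$\lim_{N\to\infty}\frac1N\log Q_N(Y_N\in B)=-I(B).$$ (b) For any open ball $\widehat B$ in $\mathcal Z$, $\widehat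 B\cap\mathcal W$ is nonempty, $I(\widehat B\cap\mathcal W)$ is finite, and $$\lim_{N\to\infty}\frac1N\log Q_N(Y_N\in\widehat B\cap\mathcal W)=-I(\widehat B\cap\mathcal W).$$
   Context: If $\tau$ is the metric on $\mathcal X$, open balls in $\mathcal W$ are the sets $\{y\in\mathcal W:\tau(x,y)<r\}$ with $x\in\mathcal W$, $r>0$, and open balls in $\mathcal Z$ are the sets $\{y\in\mathcal Z:\tau(x,y)<r\}$ with $x\in\mathcal Z$, $r>0$. "Random vector" means a measurable map. *)

theory Defs
  imports "HOL-Probability.Probability"
begin

text \<open>
  The logarithm of a probability, with \<open>log 0 = -\<infinity>\<close>. The library's \<^const>\<open>ln\<close> has
  \<open>ln 0 = 0\<close>, which would distort statements about the asymptotics of events that may have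
  probability zero for some \<open>N\<close>.
\<close>

definition ext_log :: "real \<Rightarrow> ereal" where
  "ext_log p = (if p = 0 then -\<infinity> else ereal (ln p))"

text \<open>Centres are required to lie in \<open>S\<close>.\<close>

definition open_balls :: "'a::metric_space set \<Rightarrow> 'a set set" where
  "open_balls S = {{y \<in> S. dist x y < r} | x r. x \<in> S \<and> 0 < r}"

end

theory Submission imports Defs begin

text \<open>
  The event \<open>Y N \<in> B\<close> splits into at most \<open>card (WN N)\<close> atoms, each of probability
  \<open>exp (- N (I y - \<epsilon> N y))\<close>. Since the number of atoms is subexponential, the largest atom
  decides the rate, which gives the upper bound \<open>- I(B)\<close>. For the lower bound one keeps the single
  atom given by a recovery sequence of an almost minimising point of \<open>B\<close>; it lies in \<open>B\<close>
  eventually because \<open>B\<close> is relatively open in \<open>W\<close>.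
\<close>

text \<open>The event is a finite disjoint union of level sets of \<open>Y\<close>. Measurability is
  required only of these level sets, so \<open>B\<close> can be any set.\<close>

lemma measure_finite_range:
  assumes "finite_measure M" "finite (Y ` space M)"
    and "\<And>y. y \<in> Y ` space M \<Longrightarrow> {\<omega> \<in> space M. Y \<omega> = y} \<in> sets M"
  shows "measure M {\<omega> \<in> space M. Y \<omega> \<in> B}
    = (\<Sum>y\<in>Y ` space M \<inter> B. measure M {\<omega> \<in> space M. Y \<omega> = y})"
proof -
  interpret finite_measure M by fact
  have "{\<omega> \<in> space M. Y \<omega> \<in> B} = (\<Union>y\<in>Y ` space M \<inter> B. {\<omega> \<in> space M. Y \<omega> = y})"
    by auto
  moreover have "measure M \<dots> = (\<Sum>y\<in>Y ` space M \<inter> B. measure M {\<omega> \<in> space M. Y \<omega> = y})"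
    using assms by (intro finite_measure_finite_Union) (auto simp: disjoint_family_on_def)
  ultimately show ?thesis by simp
qed

text \<open>The right-hand side is a real number, whereas p = 0 would make the left-hand side
  -\<infinity>. A local estimate with finite rate thus forces its atom to have positive
  probability.\<close>

lemma ext_log_eqD:
  assumes "ereal a * ext_log p = ereal c" "0 < a" "0 \<le> p"
  shows "0 < p" "p = exp (c / a)"
proof -
  from assms have "p \<noteq> 0" and "a * ln p = c"
    by (auto simp: ext_log_def split: if_splits)
  with assms show "0 < p" by simp
  moreover have "ln p = c / a"
    using \<open>a * ln p = c\<close> \<open>0 < a\<close> by (auto simp: field_simps)
  ultimately show "p = exp (c / a)" by (metis exp_ln)
qed

text \<open>The sum is at most the number of terms times \<open>exp c\<close>. After division by N,
  the number of terms contributes only the vanishing term of hypothesis (i). Nonemptiness and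
  positivity keep \<open>ln\<close> away from its default value at 0.\<close>

lemma ln_sum_le_ln_card:
  fixes p :: "'a \<Rightarrow> real"
  assumes "finite A" "A \<noteq> {}" "\<And>y. y \<in> A \<Longrightarrow> 0 < p y" "\<And>y. y \<in> A \<Longrightarrow> p y \<le> exp c"
  shows "ln (sum p A) \<le> ln (card A) + c"
proof -
  have "0 < sum p A" using assms by (intro sum_pos) auto
  moreover have "sum p A \<le> card A * exp c"
    using assms sum_bounded_above[of A p "exp c"] by simp
  ultimately have "ln (sum p A) \<le> ln (card A * exp c)" by simp
  also have "\<dots> = ln (card A) + c"
    using assms by (subst ln_mult) (auto simp: card_gt_0_iff)
  finally show ?thesis .
qed

text \<open>Balls in \<open>W\<close> and the traces on \<open>W\<close> of balls in the closure
  both have the form \<open>U \<inter> W\<close> with \<open>U\<close> open in the ambient space, so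
  this one limit serves both conclusions. Finiteness of the infimum is a premise here; density of
  finite-rate points supplies it later.\<close>

lemma ldp_relatively_open:
  fixes Q :: "nat \<Rightarrow> 'o measure"
    and W :: "'x::polish_space set"
    and Y :: "nat \<Rightarrow> 'o \<Rightarrow> 'x"
    and I :: "'x \<Rightarrow> ereal"
    and WN :: "nat \<Rightarrow> 'x set"
    and \<epsilon> :: "nat \<Rightarrow> 'x \<Rightarrow> real"
  assumes prob: "\<And>N. N \<ge> 1 \<Longrightarrow> prob_space (Q N)"
    and random_vector: "\<And>N. N \<ge> 1 \<Longrightarrow> Y N \<in> Q N \<rightarrow>\<^sub>M restrict_space borel W"
    and I_nonneg: "\<And>x. 0 \<le> I x"
    and i_range: "\<And>N. N \<ge> 1 \<Longrightarrow> WN N = Y N ` space (Q N)"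
    and i_finite: "\<And>N. N \<ge> 1 \<Longrightarrow> finite (WN N)"
    and i_card: "(\<lambda>N. 1 / real N * ln (real (card (WN N)))) \<longlonglongrightarrow> 0"
    and ii_finite: "\<And>N y. N \<ge> 1 \<Longrightarrow> y \<in> WN N \<Longrightarrow> I y < \<infinity>"
    and ii_local: "\<And>N y. N \<ge> 1 \<Longrightarrow> y \<in> WN N \<Longrightarrow>
        ereal (1 / real N) * ext_log (measure (Q N) {\<omega> \<in> space (Q N). Y N \<omega> = y})
          = - I y + ereal (\<epsilon> N y)"
    and ii_uniform: "\<And>e. e > 0 \<Longrightarrow> \<forall>\<^sub>F N in sequentially. \<forall>y\<in>WN N. \<bar>\<epsilon> N y\<bar> < e"
    and iv: "\<And>y. y \<in> W \<Longrightarrow> I y < \<infinity> \<Longrightarrow>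
        \<exists>s. (\<forall>N\<ge>1. s N \<in> WN N) \<and> s \<longlonglongrightarrow> y \<and> (\<lambda>N. I (s N)) \<longlonglongrightarrow> I y"
    and "open U" and inf_finite: "(INF y\<in>U \<inter> W. I y) < \<infinity>"
  shows "(\<lambda>N. ereal (1 / real N) * ext_log (measure (Q N) {\<omega> \<in> space (Q N). Y N \<omega> \<in> U \<inter> W}))
      \<longlonglongrightarrow> - (INF y\<in>U \<inter> W. I y)"
proof -
  let ?P = "\<lambda>N. measure (Q N) {\<omega> \<in> space (Q N). Y N \<omega> \<in> U \<inter> W}"
  define p where "p N y = measure (Q N) {\<omega> \<in> space (Q N). Y N \<omega> = y}" for N y
  define i where "i y = real_of_ereal (I y)" for y
  \<comment> \<open>With this bound the infimum is a real \<open>J\<close>, and the estimates below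
    can be made in the reals. Its finiteness also rules out an empty \<open>U \<inter> W\<close>,
    over which the infimum would be \<infinity>.\<close>
  have "0 \<le> (INF y\<in>U \<inter> W. I y)"
    by (intro INF_greatest I_nonneg)
  with inf_finite obtain J where J: "(INF y\<in>U \<inter> W. I y) = ereal J"
    by (cases "INF y\<in>U \<inter> W. I y") auto
  have WN_W: "WN N \<subseteq> W" if "N \<ge> 1" for N
    using measurable_space[OF random_vector[OF that]] i_range[OF that]
    by (auto simp: space_restrict_space)
  have I_eq: "I y = ereal (i y)" if "N \<ge> 1" "y \<in> WN N" for N y
    using ii_finite[OF that] I_nonneg[of y] by (cases "I y") (auto simp: i_def)
  have p: "0 < p N y" "p N y = exp (real N * (- i y + \<epsilon> N y))"
    if "N \<ge> 1" "y \<in> WN N" for N y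
    using ext_log_eqD[of "1 / real N" "p N y" "- i y + \<epsilon> N y"] ii_local[OF that] I_eq[OF that] that(1)
    by (auto simp: p_def mult.commute)
  have atoms: "{\<omega> \<in> space (Q N). Y N \<omega> = y} \<in> sets (Q N)" if "N \<ge> 1" "y \<in> WN N" for N y
  proof -
    \<comment> \<open>A singleton in \<open>W\<close> is the trace of a closed set, whether or not
      \<open>W\<close> is Borel.\<close>
    have "{y} \<in> sets (restrict_space borel W)"
      using WN_W[OF that(1)] that(2) by (auto simp: sets_restrict_space image_iff intro!: bexI[of _ "{y}"])
    from measurable_sets[OF random_vector[OF that(1)] this] show ?thesis
      by (auto simp: vimage_def Int_def conj_commute)
  qed
  have P_sum: "?P N = (\<Sum>y\<in>WN N \<inter> U. p N y)" if "N \<ge> 1" for N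
  proof -
    have "?P N = (\<Sum>y\<in>WN N \<inter> (U \<inter> W). p N y)"
      unfolding p_def i_range[OF that]
      using atoms[OF that] i_finite[OF that] prob_space.finite_measure[OF prob[OF that]]
      by (intro measure_finite_range) (auto simp: i_range[OF that])
    also have "WN N \<inter> (U \<inter> W) = WN N \<inter> U" using WN_W[OF that] by auto
    finally show ?thesis .
  qed
  \<comment> \<open>The lower bound loses \<open>e\<close> through the recovery sequence and
    \<open>e\<close> through \<epsilon>; the upper bound loses \<open>e\<close> through the
    cardinality and \<open>e\<close> through \<epsilon>. The third \<open>e\<close> makes the
    inequality strict. Positivity is recorded for the return from \<open>ln\<close> to
    \<open>ext_log\<close>.\<close>
  have bounds: "\<forall>\<^sub>F N in sequentially. 0 < ?P N \<and> \<bar>1 / real N * ln (?P N) - (- J)\<bar> < 3 * e"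
    if "e > 0" for e
  proof -
    \<comment> \<open>The infimum need not be attained, so a point within \<open>e\<close> of it is
      taken; its rate is finite and (iv) applies.\<close>
    have "(INF y\<in>U \<inter> W. I y) < ereal (J + e)" using J that by simp
    then obtain y where y: "y \<in> U" "y \<in> W" "I y < ereal (J + e)"
      by (auto simp: INF_less_iff)
    then have "I y < \<infinity>" by (cases "I y") auto
    with iv[OF y(2)] obtain s where s: "\<And>N. N \<ge> 1 \<Longrightarrow> s N \<in> WN N"
      and s_lim: "s \<longlonglongrightarrow> y" "(\<lambda>N. I (s N)) \<longlonglongrightarrow> I y"
      by blast
    have "\<forall>\<^sub>F N in sequentially. 1 / real N * ln (real (card (WN N))) < e"
      using order_tendstoD(2)[OF i_card that] .
    moreover have "\<forall>\<^sub>F N in sequentially. s N \<in> U"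
      using topological_tendstoD[OF s_lim(1) \<open>open U\<close> y(1)] .
    moreover have "\<forall>\<^sub>F N in sequentially. I (s N) < ereal (J + e)"
      using order_tendstoD(2)[OF s_lim(2) y(3)] .
    ultimately show ?thesis
      using ii_uniform[OF that] eventually_ge_at_top[of 1]
    proof eventually_elim
      case (elim N)
      let ?A = "WN N \<inter> U"
      have fin: "finite ?A" and sN: "s N \<in> ?A"
        using i_finite s elim by auto
      have pos: "0 < p N x" if "x \<in> ?A" for x using p(1) elim that by auto
      have le: "p N (s N) \<le> ?P N"
        unfolding P_sum[OF elim(5)] using fin sN pos by (intro member_le_sum) (auto intro: less_imp_le)
      have lower: "- J - 2 * e \<le> 1 / real N * ln (?P N)"
      proof -
        have "i (s N) < J + e" and "\<bar>\<epsilon> N (s N)\<bar> < e"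
          using elim I_eq[of N "s N"] sN by auto
        then have "real N * (- J - 2 * e) \<le> real N * (- i (s N) + \<epsilon> N (s N))"
          by (intro mult_left_mono) auto
        also have "\<dots> = ln (p N (s N))" using p(2)[of N "s N"] elim sN by simp
        also have "\<dots> \<le> ln (?P N)" using le pos[OF sN] by simp
        finally show ?thesis using elim(5) by (simp add: field_simps)
      qed
      have upper: "1 / real N * ln (?P N) \<le> 1 / real N * ln (card (WN N)) + (- J + e)"
      proof -
        \<comment> \<open>All atoms share this bound: \<open>x\<close> lies in
          \<open>U \<inter> W\<close>, so its rate is at least \<open>J\<close>, and the error is
          below \<open>e\<close> uniformly in \<open>x\<close>.\<close>
        have "p N x \<le> exp (real N * (- J + e))" if "x \<in> ?A" for x
        proof -
          have "(INF y\<in>U \<inter> W. I y) \<le> I x"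
            using that WN_W[OF elim(5)] by (intro INF_lower) auto
          then have "J \<le> i x" using J I_eq[of N x] elim that by auto
          moreover have "\<epsilon> N x < e" using elim(4) that by (auto simp: abs_less_iff)
          ultimately show ?thesis
            using p(2)[of N x] elim that by (auto intro!: mult_left_mono)
        qed
        then have "ln (?P N) \<le> ln (card ?A) + real N * (- J + e)"
          unfolding P_sum[OF elim(5)] using fin sN pos by (intro ln_sum_le_ln_card) auto
        also have "ln (card ?A) \<le> ln (card (WN N))"
        proof -
          \<comment> \<open>Monotonicity of \<open>ln\<close> needs a positive argument;
            \<open>s N\<close> witnesses that \<open>?A\<close> is nonempty.\<close>
          have "0 < card ?A" using fin sN by (auto simp: card_gt_0_iff)
          moreover have "card ?A \<le> card (WN N)" using i_finite[OF elim(5)] by (intro card_mono) auto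
          ultimately show ?thesis by simp
        qed
        finally show ?thesis using elim(5) by (simp add: field_simps)
      qed
      from le pos[OF sN] have "0 < ?P N" by linarith
      with lower upper elim(1) that show ?case by (auto simp: abs_less_iff)
    qed
  qed
  have "(\<lambda>N. 1 / real N * ln (?P N)) \<longlonglongrightarrow> - J"
  proof (rule tendstoI)
    fix e :: real assume "e > 0"
    then show "\<forall>\<^sub>F N in sequentially. dist (1 / real N * ln (?P N)) (- J) < e"
      using bounds[of "e / 3"] by (auto simp: dist_real_def elim: eventually_mono)
  qed
  then have "(\<lambda>N. ereal (1 / real N * ln (?P N))) \<longlonglongrightarrow> - (INF y\<in>U \<inter> W. I y)"
    by (simp add: J)
  \<comment> \<open>\<open>ext_log\<close> and \<open>ln\<close> agree once the probability is
    positive. Only this part of \<open>bounds\<close> is used, so the choice of 1 is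
    arbitrary.\<close>
  moreover have "\<forall>\<^sub>F N in sequentially.
      ereal (1 / real N * ln (?P N)) = ereal (1 / real N) * ext_log (?P N)"
    using bounds[of 1] by (auto simp: ext_log_def elim!: eventually_mono)
  ultimately show ?thesis by (rule Lim_transform_eventually)
qed

theorem theorem4p2:
  fixes Q :: "nat \<Rightarrow> 'o measure"
    and W :: "'x::polish_space set"
    and Z :: "'x set"
    and Y :: "nat \<Rightarrow> 'o \<Rightarrow> 'x"
    and I :: "'x \<Rightarrow> ereal"
    and WN :: "nat \<Rightarrow> 'x set"
    and \<epsilon> :: "nat \<Rightarrow> 'x \<Rightarrow> real"
  assumes prob: "\<And>N. N \<ge> 1 \<Longrightarrow> prob_space (Q N)"
    and rel_compact: "compact (closure W)"
    and not_closed: "\<not> closed W"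
    and Z: "Z = closure W"
    and random_vector: "\<And>N. N \<ge> 1 \<Longrightarrow> Y N \<in> Q N \<rightarrow>\<^sub>M restrict_space borel W"
    and I_nonneg: "\<And>x. 0 \<le> I x"
    and i_range: "\<And>N. N \<ge> 1 \<Longrightarrow> WN N = Y N ` space (Q N)"
    and i_finite: "\<And>N. N \<ge> 1 \<Longrightarrow> finite (WN N)"
    and i_card: "(\<lambda>N. 1 / real N * ln (real (card (WN N)))) \<longlonglongrightarrow> 0"
    and ii_finite: "\<And>N y. N \<ge> 1 \<Longrightarrow> y \<in> WN N \<Longrightarrow> I y < \<infinity>"
    and ii_local: "\<And>N y. N \<ge> 1 \<Longrightarrow> y \<in> WN N \<Longrightarrow>
        ereal (1 / real N) * ext_log (measure (Q N) {\<omega> \<in> space (Q N). Y N \<omega> = y})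
          = - I y + ereal (\<epsilon> N y)"
    and ii_uniform: "\<And>e. e > 0 \<Longrightarrow> \<forall>\<^sub>F N in sequentially. \<forall>y\<in>WN N. \<bar>\<epsilon> N y\<bar> < e"
    and iii: "\<exists>D. D \<subseteq> W \<and> W \<subseteq> closure D \<and> (\<forall>y\<in>D. I y < \<infinity>)"
    and iv: "\<And>y. y \<in> W \<Longrightarrow> I y < \<infinity> \<Longrightarrow>
        \<exists>s. (\<forall>N\<ge>1. s N \<in> WN N) \<and> s \<longlonglongrightarrow> y \<and> (\<lambda>N. I (s N)) \<longlonglongrightarrow> I y"
  shows "(\<forall>B\<in>open_balls W.
            \<bar>INF y\<in>B. I y\<bar> \<noteq> \<infinity> \<and>
            (\<lambda>N. ereal (1 / real N) * ext_log (measure (Q N) {\<omega> \<in> space (Q N). Y N \<omega> \<in> B}))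
              \<longlonglongrightarrow> - (INF y\<in>B. I y)) \<and>
         (\<forall>B\<in>open_balls Z.
            B \<inter> W \<noteq> {} \<and>
            \<bar>INF y\<in>B \<inter> W. I y\<bar> \<noteq> \<infinity> \<and>
            (\<lambda>N. ereal (1 / real N) * ext_log (measure (Q N) {\<omega> \<in> space (Q N). Y N \<omega> \<in> B \<inter> W}))
              \<longlonglongrightarrow> - (INF y\<in>B \<inter> W. I y))"
proof -
  \<comment> \<open>An open set that meets \<open>W\<close> meets the closure of the dense set
    \<open>D\<close>, hence \<open>D\<close> itself, where the rate is finite.\<close>
  have finite_inf: "\<bar>INF y\<in>U \<inter> W. I y\<bar> \<noteq> \<infinity>" "(INF y\<in>U \<inter> W. I y) < \<infinity>"
    if "open U" "U \<inter> W \<noteq> {}" for U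
  proof -
    from iii obtain D where D: "D \<subseteq> W" "W \<subseteq> closure D" "\<forall>y\<in>D. I y < \<infinity>" by blast
    with that have "U \<inter> D \<noteq> {}" using open_Int_closure_eq_empty[of U D] by blast
    with D obtain y where "y \<in> U \<inter> W" "I y < \<infinity>" by blast
    then show "(INF y\<in>U \<inter> W. I y) < \<infinity>" by (meson INF_lower le_less_trans)
    moreover have "0 \<le> (INF y\<in>U \<inter> W. I y)" by (intro INF_greatest I_nonneg)
    ultimately show "\<bar>INF y\<in>U \<inter> W. I y\<bar> \<noteq> \<infinity>" by auto
  qed
  have ldp: "(\<lambda>N. ereal (1 / real N) * ext_log (measure (Q N) {\<omega> \<in> space (Q N). Y N \<omega> \<in> U \<inter> W}))
      \<longlonglongrightarrow> - (INF y\<in>U \<inter> W. I y)" if "open U" "U \<inter> W \<noteq> {}" for U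
    by (rule ldp_relatively_open[OF prob random_vector I_nonneg i_range i_finite i_card
          ii_finite ii_local ii_uniform iv that(1) finite_inf(2)[OF that]])
  have ball_W: "\<exists>U. open U \<and> U \<inter> W \<noteq> {} \<and> B = U \<inter> W" if B: "B \<in> open_balls W" for B
  proof -
    from B obtain x r where "x \<in> W" "0 < r" "B = {y \<in> W. dist x y < r}"
      by (auto simp: open_balls_def)
    then have "x \<in> ball x r \<inter> W" "B = ball x r \<inter> W" by auto
    then show ?thesis by (intro exI[of _ "ball x r"] conjI open_ball) blast+
  qed
  have ball_Z: "\<exists>U. open U \<and> U \<inter> W \<noteq> {} \<and> B \<inter> W = U \<inter> W" if B: "B \<in> open_balls Z" for B
  proof -
    from B obtain x r where x: "x \<in> closure W" "0 < r" "B = {y \<in> Z. dist x y < r}"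
      by (auto simp: open_balls_def Z)
    \<comment> \<open>The centre may lie outside \<open>W\<close>, but it is in the closure of
      \<open>W\<close>, so every ball around it contains a point of \<open>W\<close>. Since
      \<open>W\<close> is contained in \<open>Z\<close>, intersecting with \<open>W\<close> gives
      the same set as for the ambient ball.\<close>
    then obtain y where "y \<in> W" "dist y x < r" by (auto simp: closure_approachable)
    then have "y \<in> ball x r \<inter> W" by (simp add: dist_commute)
    moreover have "B \<inter> W = ball x r \<inter> W" using x closure_subset[of W] by (auto simp: Z)
    ultimately show ?thesis by (intro exI[of _ "ball x r"] conjI open_ball) blast+
  qed
  show ?thesis
  proof (intro conjI ballI)
    fix B assume "B \<in> open_balls W"
    with ball_W obtain U where U: "open U" "U \<inter> W \<noteq> {}" and B: "B = U \<inter> W" by blast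
    show "\<bar>INF y\<in>B. I y\<bar> \<noteq> \<infinity>" unfolding B by (rule finite_inf(1)[OF U])
    show "(\<lambda>N. ereal (1 / real N) * ext_log (measure (Q N) {\<omega> \<in> space (Q N). Y N \<omega> \<in> B}))
        \<longlonglongrightarrow> - (INF y\<in>B. I y)" unfolding B by (rule ldp[OF U])
  next
    fix B assume "B \<in> open_balls Z"
    with ball_Z obtain U where U: "open U" "U \<inter> W \<noteq> {}" and B: "B \<inter> W = U \<inter> W" by blast
    show "B \<inter> W \<noteq> {}" using U B by simp
    show "\<bar>INF y\<in>B \<inter> W. I y\<bar> \<noteq> \<infinity>" unfolding B by (rule finite_inf(1)[OF U])
    show "(\<lambda>N. ereal (1 / real N) * ext_log (measure (Q N) {\<omega> \<in> space (Q N). Y N \<omega> \<in> B \<inter> W}))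
        \<longlonglongrightarrow> - (INF y\<in>B \<inter> W. I y)" unfolding B by (rule ldp[OF U])
  qed
qed

end
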